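(* Let $X$ be a compact metric space, let $f\colon X\to X$ be a continuous map, and let $x\in X$ be a shadowable point for $f$ (i.e. $x\in Sh(f)$). Then the following conditions are equivalent: (a) $x\in LSC(\omega_f)$, i.e. the set-valued map $\omega_f$ is lower semicontinuous at $x$; (b) $\omega_f(x)\subset\omega_f(y)$ for all $y\in\Omega_f(x)$ (and so, in this case, $\omega_f(x)$ is a minimal set for $f$).
   Context: $(X,d)$ is a compact metric space, $f\colon X\to X$ is continuous, and $\mathcal{K}(X)$ is the set of non-empty closed subsets of $X$. $\omega_f(x)$ is the set of $y\in X$ such that $\lim_{j\to\infty}f^{i_j}(x)=y$ for some $0\le i_1<i_2<\cdots$; $\omega_f$ is regarded as a map $X\to\mathcal{K}(X)$. $\Omega_f(x)$ is the set of $y\in X$ for which there are $x_j\in X$, $j\ge1$, and $0\le i_1<i_2<\cdots$ with $\lim_{j\to\infty}x_j=x$ and $\lim_{j\to\infty}f^{i_j}(x_j)=y$. A map $\phi\colon X\to\mathcal{K}(X)$ is lower semicontinuous at $x$ if for every open $U\subset X$ with $\phi(x)\cap U\ne\emptyset$ there is $\delta>0$ such that $d(x,y)\le\delta$ implies $\phi(y)\cap U\ne\emptyset$ for all $y\in X$. $LSC(\phi)$ is the set of lower semicontinuity points of $\phi$. A non-empty closed set $M\subset X$ with $f(M)\subset M$ is a minimal set for $f$ if $M=\omega_f(x)$ for all $x\in M$. For $\delta>0$, a sequence $(x_i)_{i\ge0}$ in $X$ is a $\delta$-pseudo orbit of $f$ if $\sup_{i\ge0}d(f(x_i),x_{i+1})\le\delta$;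 it is $\epsilon$-shadowed by $y\in X$ if $\sup_{i\ge0}d(x_i,f^i(y))\le\epsilon$. A point $x\in X$ is shadowable for $f$ if for every $\epsilon>0$ there is $\delta>0$ such that every $\delta$-pseudo orbit $(x_i)_{i\ge0}$ of $f$ with $x_0=x$ is $\epsilon$-shadowed by some $y\in X$. $Sh(f)$ is the set of shadowable points. *)

theory Defs
  imports "HOL-Analysis.Analysis"
begin

text \<open>
  The space is a compact subset \<open>X\<close> of an ambient metric type, with the restricted metric; all
  notions are relative to \<open>X\<close>. A map of the space is a function with \<open>f ` X \<subseteq> X\<close> whose values
  outside \<open>X\<close> are irrelevant.
\<close>

definition nonempty_closed_subsets :: "'a::metric_space set \<Rightarrow> 'a set set"
  where "nonempty_closed_subsets X = {C. C \<noteq> {} \<and> closedin (top_of_set X) C}"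

definition omega_limit :: "'a::metric_space set \<Rightarrow> ('a \<Rightarrow> 'a) \<Rightarrow> 'a \<Rightarrow> 'a set"
  where "omega_limit X f x =
    {y \<in> X. \<exists>i :: nat \<Rightarrow> nat. strict_mono i \<and> (\<lambda>j. (f ^^ i j) x) \<longlonglongrightarrow> y}"

definition Omega_limit :: "'a::metric_space set \<Rightarrow> ('a \<Rightarrow> 'a) \<Rightarrow> 'a \<Rightarrow> 'a set"
  where "Omega_limit X f x =
    {y \<in> X. \<exists>(z :: nat \<Rightarrow> 'a) (i :: nat \<Rightarrow> nat). range z \<subseteq> X \<and> strict_mono i \<and>
        z \<longlonglongrightarrow> x \<and> (\<lambda>j. (f ^^ i j) (z j)) \<longlonglongrightarrow> y}"

definition LSC :: "'a::metric_space set \<Rightarrow> ('a \<Rightarrow> 'a set) \<Rightarrow> 'a set"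
  where "LSC X \<phi> =
    {x \<in> X. \<forall>U. openin (top_of_set X) U \<and> \<phi> x \<inter> U \<noteq> {} \<longrightarrow>
        (\<exists>\<delta>>0. \<forall>y\<in>X. dist x y \<le> \<delta> \<longrightarrow> \<phi> y \<inter> U \<noteq> {})}"

definition minimal_set :: "'a::metric_space set \<Rightarrow> ('a \<Rightarrow> 'a) \<Rightarrow> 'a set \<Rightarrow> bool"
  where "minimal_set X f M \<longleftrightarrow>
    M \<in> nonempty_closed_subsets X \<and> f ` M \<subseteq> M \<and> (\<forall>x\<in>M. M = omega_limit X f x)"

definition pseudo_orbit :: "'a::metric_space set \<Rightarrow> ('a \<Rightarrow> 'a) \<Rightarrow> real \<Rightarrow> (nat \<Rightarrow> 'a) \<Rightarrow> bool"
  where "pseudo_orbit X f \<delta> \<xi> \<longleftrightarrow> range \<xi> \<subseteq> X \<and> (\<forall>i. dist (f (\<xi> i)) (\<xi> (Suc i)) \<le> \<delta>)"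

definition shadowed_by :: "('a::metric_space \<Rightarrow> 'a) \<Rightarrow> real \<Rightarrow> (nat \<Rightarrow> 'a) \<Rightarrow> 'a \<Rightarrow> bool"
  where "shadowed_by f \<epsilon> \<xi> y \<longleftrightarrow> (\<forall>i. dist (\<xi> i) ((f ^^ i) y) \<le> \<epsilon>)"

definition Sh :: "'a::metric_space set \<Rightarrow> ('a \<Rightarrow> 'a) \<Rightarrow> 'a set"
  where "Sh X f =
    {x \<in> X. \<forall>\<epsilon>>0. \<exists>\<delta>>0. \<forall>\<xi>. pseudo_orbit X f \<delta> \<xi> \<and> \<xi> 0 = x \<longrightarrow>
        (\<exists>y\<in>X. shadowed_by f \<epsilon> \<xi> y)}"

lemma funpow_in_invariant:
  assumes "f ` X \<subseteq> X" and "x \<in> X"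
  shows "(f ^^ n) x \<in> X"
  using assms by (induction n) auto

lemma omega_limit_iff_frequently:
  "y \<in> omega_limit X f x \<longleftrightarrow>
     y \<in> X \<and> (\<forall>e>0. \<forall>N. \<exists>n\<ge>N. dist ((f ^^ n) x) y < e)"  (is "_ \<longleftrightarrow> _ \<and> ?F")
proof -
  have "?F" if i: "strict_mono i" and l: "(\<lambda>j. (f ^^ i j) x) \<longlonglongrightarrow> y" for i :: "nat \<Rightarrow> nat"
  proof (intro allI impI)
    fix e :: real and N assume "e > 0"
    then obtain K where K: "\<And>j. j \<ge> K \<Longrightarrow> dist ((f ^^ i j) x) y < e"
      using l unfolding lim_sequentially by blast
    have "i (max K N) \<ge> N"
      using seq_suble[OF i, of "max K N"] by linarith
    with K[of "max K N"] show "\<exists>n\<ge>N. dist ((f ^^ n) x) y < e" by auto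
  qed
  moreover have "\<exists>i :: nat \<Rightarrow> nat. strict_mono i \<and> (\<lambda>j. (f ^^ i j) x) \<longlonglongrightarrow> y" if F: ?F
  proof -
    have "\<exists>i. \<forall>n. dist ((f ^^ i n) x) y < 1 / real (Suc n) \<and> i n < i (Suc n)"
    proof (rule dependent_nat_choice)
      show "\<exists>m. dist ((f ^^ m) x) y < 1 / real (Suc 0)"
        using F[rule_format, of 1 0] by simp
      show "\<exists>m'. dist ((f ^^ m') x) y < 1 / real (Suc (Suc n)) \<and> m < m'" for m n
        using F[rule_format, of "1 / real (Suc (Suc n))" "Suc m"] by (auto simp: Suc_le_eq)
    qed
    then obtain i where i: "\<And>n. dist ((f ^^ i n) x) y < 1 / real (Suc n)"
      and "\<And>n. i n < i (Suc n)" by blast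
    then have "strict_mono i" by (simp add: strict_mono_Suc_iff)
    moreover have "(\<lambda>n. dist ((f ^^ i n) x) y) \<longlonglongrightarrow> 0"
    proof (rule tendsto_sandwich[where f = "\<lambda>_. 0"])
      show "(\<lambda>n. 1 / real (Suc n)) \<longlonglongrightarrow> 0"
        using LIMSEQ_inverse_real_of_nat by (simp add: inverse_eq_divide)
      show "\<forall>\<^sub>F n in sequentially. dist ((f ^^ i n) x) y \<le> 1 / real (Suc n)"
        using i less_imp_le by (intro always_eventually) blast
    qed auto
    ultimately show ?thesis using tendsto_dist_iff[of "\<lambda>n. (f ^^ i n) x"] by blast
  qed
  ultimately show ?thesis unfolding omega_limit_def by blast
qed

lemma omega_limit_in_nonempty_closed_subsets:
  assumes X: "compact X" and f: "f ` X \<subseteq> X" and x: "x \<in> X"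
  shows "omega_limit X f x \<in> nonempty_closed_subsets X"
proof -
  have "\<forall>n. (f ^^ n) x \<in> X"
    using funpow_in_invariant[OF f x] by blast
  then obtain l r where "l \<in> X" "strict_mono r" "((\<lambda>n. (f ^^ n) x) \<circ> r) \<longlonglongrightarrow> l"
    using X[unfolded compact_def, rule_format, of "\<lambda>n. (f ^^ n) x"] by auto
  then have "l \<in> omega_limit X f x"
    unfolding omega_limit_def o_def by blast
  moreover have "closed (omega_limit X f x)"
    unfolding closed_sequential_limits
  proof (intro allI impI, elim conjE)
    fix s y assume s: "\<forall>n. s n \<in> omega_limit X f x" and y: "s \<longlonglongrightarrow> y"
    have "y \<in> X"
    proof (rule closed_sequentially[OF compact_imp_closed[OF X] _ y])
      show "s n \<in> X" for n
        using s[rule_format, of n] by (simp add: omega_limit_def)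
    qed
    moreover have "\<exists>n\<ge>N. dist ((f ^^ n) x) y < e" if "e > 0" for e N
    proof -
      obtain k where k: "dist (s k) y < e / 2"
        using metric_LIMSEQ_D[OF y, of "e / 2"] \<open>e > 0\<close> by auto
      obtain n where n: "n \<ge> N" "dist ((f ^^ n) x) (s k) < e / 2"
        using s[rule_format, of k, unfolded omega_limit_iff_frequently, THEN conjunct2,
            rule_format, of "e / 2" N] \<open>e > 0\<close> by auto
      have "dist ((f ^^ n) x) y < e"
        using k n(2) dist_triangle[of "(f ^^ n) x" y "s k"] by linarith
      with n(1) show ?thesis by blast
    qed
    ultimately show "y \<in> omega_limit X f x"
      unfolding omega_limit_iff_frequently by blast
  qed
  moreover have "omega_limit X f x \<subseteq> X"
    unfolding omega_limit_def by blast
  ultimately show ?thesis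
    unfolding nonempty_closed_subsets_def by (auto intro: closed_subset)
qed

end

theory Submission
  imports Defs
begin

text \<open>
  If \<open>\<omega>\<close> is lower semicontinuous at \<open>x\<close> and \<open>y \<in> \<Omega>(x)\<close>, the sequence that starts at \<open>x\<close>, follows the
  orbit of a point near \<open>x\<close> until it comes close to \<open>y\<close> and then follows the orbit of \<open>y\<close> is a pseudo
  orbit. A point \<open>w\<close> shadowing it is close to \<open>x\<close>, so \<open>\<omega>(w)\<close> comes close to any given \<open>p \<in> \<omega>(x)\<close>;
  since the orbit of \<open>w\<close> finally stays close to that of \<open>y\<close>, so does the orbit of \<open>y\<close>.

  Conversely, let \<open>U\<close> be open and meet \<open>\<omega>(x)\<close>, and let \<open>V\<close> be the open set of points whose orbit
  enters \<open>U\<close>. If \<open>\<omega>(x) \<subseteq> \<omega>(y)\<close> for all \<open>y \<in> \<Omega>(x)\<close>, then \<open>\<Omega>(x) \<subseteq> V\<close>. The map \<open>\<Omega>\<close> has a closed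
  graph in a compact space and is therefore upper semicontinuous, so \<open>\<omega>(z) \<subseteq> \<Omega>(z) \<subseteq> V\<close> for all \<open>z\<close>
  near \<open>x\<close>; being invariant, \<open>\<omega>(z)\<close> then meets \<open>U\<close>.
\<close>

definition Kuratowski_limsup :: "(nat \<Rightarrow> 'a::topological_space set) \<Rightarrow> 'a set"
  where "Kuratowski_limsup A = (\<Inter>N. closure (\<Union>n\<in>{N..}. A n))"

lemma closed_Kuratowski_limsup: "closed (Kuratowski_limsup A)"
  unfolding Kuratowski_limsup_def by auto

lemma mem_Kuratowski_limsup_iff:
  "p \<in> Kuratowski_limsup A \<longleftrightarrow>
     (\<forall>B. open B \<longrightarrow> p \<in> B \<longrightarrow> (\<forall>N. \<exists>n\<ge>N. A n \<inter> B \<noteq> {}))"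
proof -
  have "p \<in> closure S \<longleftrightarrow> (\<forall>B. open B \<longrightarrow> p \<in> B \<longrightarrow> S \<inter> B \<noteq> {})" for S
    unfolding closure_iff_nhds_not_empty by blast
  then show ?thesis
    unfolding Kuratowski_limsup_def by (simp add: Bex_def) blast
qed

lemma Kuratowski_limsupI:
  assumes i: "strict_mono i" and s: "\<And>k. s k \<in> A (i k)" "s \<longlonglongrightarrow> p"
  shows "p \<in> Kuratowski_limsup A"
  unfolding mem_Kuratowski_limsup_iff
proof (intro allI impI)
  fix B N assume "open B" "p \<in> B"
  then obtain K where "\<And>k. k \<ge> K \<Longrightarrow> s k \<in> B"
    using topological_tendstoD[OF s(2)] unfolding eventually_sequentially by blast
  then have "s (max K N) \<in> A (i (max K N)) \<inter> B"
    using s(1) by simp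
  moreover have "i (max K N) \<ge> N"
    using seq_suble[OF i, of "max K N"] by simp
  ultimately show "\<exists>n\<ge>N. A n \<inter> B \<noteq> {}" by blast
qed

lemma Kuratowski_limsupE:
  fixes p :: "'a::first_countable_topology"
  assumes p: "p \<in> Kuratowski_limsup A"
  obtains i s where "strict_mono i" "\<And>k. s k \<in> A (i k)" "s \<longlonglongrightarrow> p"
proof -
  obtain B where B: "\<And>k::nat. open (B k)" "\<And>k. p \<in> B k"
    and basis: "\<And>S. open S \<Longrightarrow> p \<in> S \<Longrightarrow> \<forall>\<^sub>F k in sequentially. B k \<subseteq> S"
    using countable_basis_at_decseq[of p] by metis
  have meets: "\<exists>n\<ge>N. A n \<inter> B k \<noteq> {}" for k N
    using p B unfolding mem_Kuratowski_limsup_iff by blast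
  have "\<exists>i. \<forall>k. A (i k) \<inter> B k \<noteq> {} \<and> i k < i (Suc k)"
  proof (rule dependent_nat_choice)
    show "\<exists>n. A n \<inter> B 0 \<noteq> {}"
      using meets by blast
    show "\<exists>n'. A n' \<inter> B (Suc k) \<noteq> {} \<and> n < n'" for n k
      using meets[of "Suc n" "Suc k"] by (auto simp: Suc_le_eq)
  qed
  then obtain i where "strict_mono i" and "\<And>k. \<exists>s. s \<in> A (i k) \<and> s \<in> B k"
    unfolding strict_mono_Suc_iff by blast
  moreover from this(2) obtain s where s: "\<And>k. s k \<in> A (i k)" "\<And>k. s k \<in> B k"
    by metis
  moreover have "s \<longlonglongrightarrow> p"
  proof (rule topological_tendstoI)
    fix S assume "open S" "p \<in> S"
    then show "\<forall>\<^sub>F k in sequentially. s k \<in> S"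
      using eventually_mono[OF basis[of S], of "\<lambda>k. s k \<in> S"] s(2) by blast
  qed
  ultimately show thesis
    using that by blast
qed

lemma continuous_on_funpow:
  fixes f :: "'a::topological_space \<Rightarrow> 'a"
  assumes "continuous_on X f" and "f ` X \<subseteq> X"
  shows "continuous_on X (f ^^ n)"
proof (induction n)
  case (Suc n)
  have "(f ^^ n) ` X \<subseteq> X"
    using funpow_in_invariant[OF assms(2)] by blast
  then show ?case
    using continuous_on_compose2[OF assms(1) Suc.IH] by (simp add: o_def)
qed (simp add: id_def)

lemma closed_omega_limit:
  assumes "compact X" and "f ` X \<subseteq> X" and "x \<in> X"
  shows "closed (omega_limit X f x)"
  using omega_limit_in_nonempty_closed_subsets[OF assms] compact_imp_closed[OF assms(1)]
  unfolding nonempty_closed_subsets_def by (auto intro: closedin_closed_trans)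

lemma omega_limit_nonempty:
  assumes "compact X" and "f ` X \<subseteq> X" and "x \<in> X"
  shows "omega_limit X f x \<noteq> {}"
  using omega_limit_in_nonempty_closed_subsets[OF assms]
  unfolding nonempty_closed_subsets_def by blast

lemma funpow_in_omega_limit:
  assumes f: "continuous_on X f" "f ` X \<subseteq> X" and x: "x \<in> X" and y: "y \<in> omega_limit X f x"
  shows "(f ^^ n) y \<in> omega_limit X f x"
proof -
  obtain i where i: "strict_mono i" "(\<lambda>j. (f ^^ i j) x) \<longlonglongrightarrow> y" and "y \<in> X"
    using y unfolding omega_limit_def by blast
  have "(\<lambda>j. (f ^^ n) ((f ^^ i j) x)) \<longlonglongrightarrow> (f ^^ n) y"
    using continuous_on_tendsto_compose[OF continuous_on_funpow[OF f] i(2) \<open>y \<in> X\<close>]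
      funpow_in_invariant[OF f(2) x] by simp
  then have "(\<lambda>j. (f ^^ (n + i j)) x) \<longlonglongrightarrow> (f ^^ n) y"
    by (simp add: funpow_add)
  moreover have "strict_mono (\<lambda>j. n + i j)"
    using i(1) by (simp add: strict_mono_def)
  ultimately show ?thesis
    using funpow_in_invariant[OF f(2) \<open>y \<in> X\<close>] unfolding omega_limit_def by blast
qed

lemma omega_limit_subset_if_mem:
  assumes X: "compact X" and f: "continuous_on X f" "f ` X \<subseteq> X"
    and x: "x \<in> X" and y: "y \<in> omega_limit X f x"
  shows "omega_limit X f y \<subseteq> omega_limit X f x"
proof
  fix p assume "p \<in> omega_limit X f y"
  then obtain i where "(\<lambda>j. (f ^^ i j) y) \<longlonglongrightarrow> p"
    unfolding omega_limit_def by blast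
  with closed_omega_limit[OF X f(2) x] funpow_in_omega_limit[OF f x y]
  show "p \<in> omega_limit X f x"
    by (rule closed_sequentially)
qed

lemma minimal_set_omega_limitI:
  assumes X: "compact X" and f: "continuous_on X f" "f ` X \<subseteq> X" and x: "x \<in> X"
    and sub: "\<And>y. y \<in> omega_limit X f x \<Longrightarrow> omega_limit X f x \<subseteq> omega_limit X f y"
  shows "minimal_set X f (omega_limit X f x)"
  unfolding minimal_set_def
proof (intro conjI ballI)
  show "omega_limit X f x \<in> nonempty_closed_subsets X"
    by (rule omega_limit_in_nonempty_closed_subsets[OF X f(2) x])
  show "f ` omega_limit X f x \<subseteq> omega_limit X f x"
    using funpow_in_omega_limit[OF f x, of _ 1] by auto
  show "omega_limit X f x = omega_limit X f y" if "y \<in> omega_limit X f x" for y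
    using sub[OF that] omega_limit_subset_if_mem[OF X f x that] by blast
qed

lemma omega_limit_subset_Omega_limit:
  assumes "x \<in> X"
  shows "omega_limit X f x \<subseteq> Omega_limit X f x"
proof
  fix y assume "y \<in> omega_limit X f x"
  then obtain i where "y \<in> X" "strict_mono i" "(\<lambda>j. (f ^^ i j) x) \<longlonglongrightarrow> y"
    unfolding omega_limit_def by blast
  with assms show "y \<in> Omega_limit X f x"
    unfolding Omega_limit_def by (auto intro!: exI[of _ "\<lambda>_. x"] exI[of _ i])
qed

definition iterate_graph :: "'a set \<Rightarrow> ('a \<Rightarrow> 'a) \<Rightarrow> nat \<Rightarrow> ('a \<times> 'a) set"
  where "iterate_graph X f n = (\<lambda>z. (z, (f ^^ n) z)) ` X"

lemma Omega_limit_iff_Kuratowski_limsup: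
  "y \<in> Omega_limit X f x \<longleftrightarrow> y \<in> X \<and> (x, y) \<in> Kuratowski_limsup (iterate_graph X f)"
proof (intro iffI conjI)
  assume "y \<in> Omega_limit X f x"
  then obtain z i where "y \<in> X" and z: "range z \<subseteq> X" and i: "strict_mono i"
    and lim: "z \<longlonglongrightarrow> x" "(\<lambda>j. (f ^^ i j) (z j)) \<longlonglongrightarrow> y"
    unfolding Omega_limit_def by blast
  then show "y \<in> X" by blast
  have "(z j, (f ^^ i j) (z j)) \<in> iterate_graph X f (i j)" for j
    using z unfolding iterate_graph_def by blast
  then show "(x, y) \<in> Kuratowski_limsup (iterate_graph X f)"
    using tendsto_Pair[OF lim] by (rule Kuratowski_limsupI[OF i])
next
  assume "y \<in> X \<and> (x, y) \<in> Kuratowski_limsup (iterate_graph X f)"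
  then have "y \<in> X" "(x, y) \<in> Kuratowski_limsup (iterate_graph X f)"
    by blast+
  from this(2) obtain i s where "strict_mono i"
    and s: "\<And>k. s k \<in> iterate_graph X f (i k)" "s \<longlonglongrightarrow> (x, y)"
    by (rule Kuratowski_limsupE) (rule that)
  from s(1) have "\<forall>k. \<exists>z\<in>X. s k = (z, (f ^^ i k) z)"
    unfolding iterate_graph_def by blast
  then obtain z where z: "\<And>k. z k \<in> X" "\<And>k. s k = (z k, (f ^^ i k) (z k))"
    by metis
  have "z \<longlonglongrightarrow> x" "(\<lambda>k. (f ^^ i k) (z k)) \<longlonglongrightarrow> y"
    using tendsto_fst[OF s(2)] tendsto_snd[OF s(2)] by (simp_all add: z(2))
  moreover have "range z \<subseteq> X"
    using z(1) by blast
  ultimately show "y \<in> Omega_limit X f x"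
    using \<open>y \<in> X\<close> \<open>strict_mono i\<close> unfolding Omega_limit_def by blast
qed

lemma Omega_limit_approachable:
  assumes "y \<in> Omega_limit X f x" and "e > 0"
  obtains n z where "n \<ge> N" "z \<in> X" "dist z x < e" "dist ((f ^^ n) z) y < e"
proof -
  have "(x, y) \<in> closure (\<Union>n\<in>{N..}. iterate_graph X f n)"
    using assms(1) unfolding Omega_limit_iff_Kuratowski_limsup Kuratowski_limsup_def by blast
  then obtain n z where "n \<ge> N" "z \<in> X" "dist (z, (f ^^ n) z) (x, y) < e"
    using \<open>e > 0\<close> unfolding closure_approachable iterate_graph_def by force
  with that show thesis
    using dist_fst_le[of "(z, (f ^^ n) z)" "(x, y)"] dist_snd_le[of "(z, (f ^^ n) z)" "(x, y)"]
    by simp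
qed

lemma Omega_limit_upper_semicontinuous:
  assumes X: "compact X" and V: "openin (top_of_set X) V" and sub: "Omega_limit X f x \<subseteq> V"
  shows "\<forall>\<^sub>F z in nhds x. Omega_limit X f z \<subseteq> V"
proof -
  let ?G = "Kuratowski_limsup (iterate_graph X f)"
  note mem = Omega_limit_iff_Kuratowski_limsup[of _ X f]
  have "compact (X - V)"
    using X V by (auto simp: openin_open Diff_Int intro: compact_diff)
  moreover have "open (- ?G)"
    using closed_Kuratowski_limsup by (rule open_Compl)
  moreover have "{x} \<times> (X - V) \<subseteq> - ?G"
    using sub mem by blast
  ultimately obtain W where "x \<in> W" "open W" "W \<times> (X - V) \<subseteq> - ?G"
    using Elementary_Topology.tube_lemma[of "X - V" "- ?G" x] by blast
  then show ?thesis
    using mem unfolding eventually_nhds by blast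
qed

definition hitting_set :: "'a set \<Rightarrow> ('a \<Rightarrow> 'a) \<Rightarrow> 'a set \<Rightarrow> 'a set"
  where "hitting_set X f U = {y \<in> X. \<exists>n. (f ^^ n) y \<in> U}"

lemma openin_hitting_set:
  assumes f: "continuous_on X f" "f ` X \<subseteq> X" and U: "openin (top_of_set X) U"
  shows "openin (top_of_set X) (hitting_set X f U)"
proof -
  have "openin (top_of_set X) (X \<inter> (f ^^ n) -` U)" for n
    using continuous_openin_preimage[OF continuous_on_funpow[OF f] _ U] funpow_in_invariant[OF f(2)]
    by blast
  then have "openin (top_of_set X) (\<Union>n. X \<inter> (f ^^ n) -` U)"
    by blast
  also have "(\<Union>n. X \<inter> (f ^^ n) -` U) = hitting_set X f U"
    unfolding hitting_set_def by blast
  finally show ?thesis .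
qed

lemma mem_hitting_set_if_omega_limit_meets:
  assumes f: "f ` X \<subseteq> X" and y: "y \<in> X" and U: "openin (top_of_set X) U"
    and meets: "omega_limit X f y \<inter> U \<noteq> {}"
  shows "y \<in> hitting_set X f U"
proof -
  obtain p where p: "p \<in> omega_limit X f y" "p \<in> U"
    using meets by blast
  obtain e where e: "e > 0" "\<And>q. q \<in> X \<Longrightarrow> dist q p < e \<Longrightarrow> q \<in> U"
    using U p(2) unfolding openin_euclidean_subtopology_iff by blast
  obtain n where "dist ((f ^^ n) y) p < e"
    using p(1) e(1) unfolding omega_limit_iff_frequently by blast
  with e(2) y show ?thesis
    using funpow_in_invariant[OF f y] unfolding hitting_set_def by blast
qed

lemma omega_limit_meets_if_meets_hitting_set:
  assumes f: "continuous_on X f" "f ` X \<subseteq> X" and x: "x \<in> X"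
    and meets: "omega_limit X f x \<inter> hitting_set X f U \<noteq> {}"
  shows "omega_limit X f x \<inter> U \<noteq> {}"
  using meets funpow_in_omega_limit[OF f x] unfolding hitting_set_def by blast

lemma LSC_omega_limitI:
  assumes X: "compact X" and f: "continuous_on X f" "f ` X \<subseteq> X" and x: "x \<in> X"
    and sub: "\<And>y. y \<in> Omega_limit X f x \<Longrightarrow> omega_limit X f x \<subseteq> omega_limit X f y"
  shows "x \<in> LSC X (omega_limit X f)"
  unfolding LSC_def mem_Collect_eq
proof (intro conjI allI impI x, elim conjE)
  fix U assume U: "openin (top_of_set X) U" and meets: "omega_limit X f x \<inter> U \<noteq> {}"
  have "Omega_limit X f x \<subseteq> hitting_set X f U"
  proof
    fix y assume y: "y \<in> Omega_limit X f x"
    then have "y \<in> X"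
      unfolding Omega_limit_def by blast
    moreover have "omega_limit X f y \<inter> U \<noteq> {}"
      using sub[OF y] meets by blast
    ultimately show "y \<in> hitting_set X f U"
      using mem_hitting_set_if_omega_limit_meets[OF f(2) _ U] by blast
  qed
  then have "\<forall>\<^sub>F z in nhds x. Omega_limit X f z \<subseteq> hitting_set X f U"
    by (rule Omega_limit_upper_semicontinuous[OF X openin_hitting_set[OF f U]])
  then obtain \<delta> where "\<delta> > 0"
    and \<delta>: "\<And>z. dist x z \<le> \<delta> \<Longrightarrow> Omega_limit X f z \<subseteq> hitting_set X f U"
    unfolding eventually_nhds_metric_le by (auto simp: dist_commute)
  have "omega_limit X f z \<inter> U \<noteq> {}" if z: "z \<in> X" "dist x z \<le> \<delta>" for z
  proof (rule omega_limit_meets_if_meets_hitting_set[OF f z(1)])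
    show "omega_limit X f z \<inter> hitting_set X f U \<noteq> {}"
      using omega_limit_nonempty[OF X f(2) z(1)] omega_limit_subset_Omega_limit[OF z(1), of f]
        \<delta>[OF z(2)] by blast
  qed
  with \<open>\<delta> > 0\<close> show "\<exists>\<delta>>0. \<forall>z\<in>X. dist x z \<le> \<delta> \<longrightarrow> omega_limit X f z \<inter> U \<noteq> {}"
    by blast
qed

lemma LSC_approachable:
  assumes lsc: "x \<in> LSC X \<phi>" and p: "p \<in> \<phi> x" "p \<in> X" and "e > 0"
  obtains \<delta> where "\<delta> > 0" "\<And>w. w \<in> X \<Longrightarrow> dist x w \<le> \<delta> \<Longrightarrow> \<exists>q\<in>\<phi> w. dist q p < e"
proof -
  have "openin (top_of_set X) (X \<inter> ball p e)"
    by (simp add: openin_open_Int)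
  moreover have "\<phi> x \<inter> (X \<inter> ball p e) \<noteq> {}"
    using p \<open>e > 0\<close> centre_in_ball by blast
  ultimately obtain \<delta> where "\<delta> > 0"
    and \<delta>: "\<And>w. w \<in> X \<Longrightarrow> dist x w \<le> \<delta> \<Longrightarrow> \<phi> w \<inter> (X \<inter> ball p e) \<noteq> {}"
    using lsc[unfolded LSC_def mem_Collect_eq, THEN conjunct2, rule_format, of "X \<inter> ball p e"]
    by blast
  have "\<exists>q\<in>\<phi> w. dist q p < e" if "w \<in> X" "dist x w \<le> \<delta>" for w
    using \<delta>[OF that] by (auto simp: dist_commute)
  with \<open>\<delta> > 0\<close> show thesis by (rule that)
qed

definition splice_orbits :: "('a \<Rightarrow> 'a) \<Rightarrow> 'a \<Rightarrow> 'a \<Rightarrow> nat \<Rightarrow> 'a \<Rightarrow> nat \<Rightarrow> 'a"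
  where "splice_orbits f x z m y k =
    (if k = 0 then x else if k < m then (f ^^ k) z else (f ^^ (k - m)) y)"

text \<open>The bound \<open>2 \<le> m\<close> keeps the jump out of \<open>x\<close> and the jump onto \<open>y\<close> in separate steps.\<close>

lemma pseudo_orbit_splice_orbits:
  assumes f: "f ` X \<subseteq> X" and "x \<in> X" "y \<in> X" "z \<in> X" and "\<delta> \<ge> 0" and "m \<ge> 2"
    and "dist (f x) (f z) \<le> \<delta>" and "dist ((f ^^ m) z) y \<le> \<delta>"
  shows "pseudo_orbit X f \<delta> (splice_orbits f x z m y)"
  unfolding pseudo_orbit_def
proof (intro conjI allI)
  show "range (splice_orbits f x z m y) \<subseteq> X"
    using assms funpow_in_invariant[OF f] by (auto simp: splice_orbits_def)
  fix k
  consider "k = 0" | "k > 0" "Suc k < m" | "k > 0" "Suc k = m" | "k \<ge> m"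
    by linarith
  then show "dist (f (splice_orbits f x z m y k)) (splice_orbits f x z m y (Suc k)) \<le> \<delta>"
    by cases (use assms in \<open>auto simp: splice_orbits_def Suc_diff_le\<close>)
qed

lemma Sh_traces_Omega_limit:
  assumes f: "continuous (at x within X) f" "f ` X \<subseteq> X" and x: "x \<in> Sh X f"
    and y: "y \<in> Omega_limit X f x" and "\<epsilon> > 0"
  obtains w m where "w \<in> X" "dist x w \<le> \<epsilon>" "\<And>k. dist ((f ^^ k) y) ((f ^^ (k + m)) w) \<le> \<epsilon>"
proof -
  have "x \<in> X" "y \<in> X"
    using x y unfolding Sh_def Omega_limit_def by auto
  obtain \<delta> where "\<delta> > 0"
    and shadow: "\<And>\<xi>. pseudo_orbit X f \<delta> \<xi> \<Longrightarrow> \<xi> 0 = x \<Longrightarrow> \<exists>w\<in>X. shadowed_by f \<epsilon> \<xi> w"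
    using x \<open>\<epsilon> > 0\<close> unfolding Sh_def by blast
  obtain \<gamma> where "\<gamma> > 0" and \<gamma>: "\<And>z. z \<in> X \<Longrightarrow> dist z x < \<gamma> \<Longrightarrow> dist (f z) (f x) < \<delta>"
    using f(1) \<open>\<delta> > 0\<close> unfolding continuous_within_eps_delta by blast
  obtain m z where "m \<ge> 2" "z \<in> X" "dist z x < min \<gamma> \<delta>" "dist ((f ^^ m) z) y < min \<gamma> \<delta>"
    using Omega_limit_approachable[OF y, of "min \<gamma> \<delta>"] \<open>\<gamma> > 0\<close> \<open>\<delta> > 0\<close> by (metis min_less_iff_conj)
  moreover from this have "dist (f x) (f z) \<le> \<delta>"
    using \<gamma>[of z] by (simp add: dist_commute)
  ultimately have "pseudo_orbit X f \<delta> (splice_orbits f x z m y)"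
    using \<open>x \<in> X\<close> \<open>y \<in> X\<close> \<open>\<delta> > 0\<close> by (intro pseudo_orbit_splice_orbits[OF f(2)]) auto
  then obtain w where "w \<in> X"
    and w: "\<And>k. dist (splice_orbits f x z m y k) ((f ^^ k) w) \<le> \<epsilon>"
    using shadow[of "splice_orbits f x z m y"] unfolding shadowed_by_def
    by (auto simp: splice_orbits_def[of f x z m y 0])
  show thesis
  proof (rule that[OF \<open>w \<in> X\<close>])
    show "dist x w \<le> \<epsilon>"
      using w[of 0] by (simp add: splice_orbits_def)
    show "dist ((f ^^ k) y) ((f ^^ (k + m)) w) \<le> \<epsilon>" for k
      using w[of "k + m"] \<open>m \<ge> 2\<close> by (simp add: splice_orbits_def)
  qed
qed

lemma omega_limit_approached_by_traced_orbit:
  assumes traced: "\<And>k. dist ((f ^^ k) y) ((f ^^ (k + m)) w) \<le> \<epsilon>"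
    and q: "q \<in> omega_limit X f w" and "e > 0"
  shows "\<exists>n\<ge>N. dist ((f ^^ n) y) q < \<epsilon> + e"
proof -
  obtain n where n: "n \<ge> N + m" "dist ((f ^^ n) w) q < e"
    using q \<open>e > 0\<close> unfolding omega_limit_iff_frequently by blast
  have "dist ((f ^^ (n - m)) y) q \<le> dist ((f ^^ (n - m)) y) ((f ^^ n) w) + dist ((f ^^ n) w) q"
    by (rule dist_triangle)
  also have "\<dots> < \<epsilon> + e"
    using traced[of "n - m"] n by simp
  finally show ?thesis
    using n(1) by (intro exI[of _ "n - m"]) simp
qed

lemma omega_limit_subset_of_LSC:
  assumes f: "continuous (at x within X) f" "f ` X \<subseteq> X" and x: "x \<in> Sh X f"
    and lsc: "x \<in> LSC X (omega_limit X f)" and y: "y \<in> Omega_limit X f x"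
  shows "omega_limit X f x \<subseteq> omega_limit X f y"
proof
  fix p assume p: "p \<in> omega_limit X f x"
  then have "p \<in> X"
    unfolding omega_limit_def by blast
  have "\<exists>n\<ge>N. dist ((f ^^ n) y) p < e" if "e > 0" for e N
  proof -
    have "e / 3 > 0"
      using \<open>e > 0\<close> by simp
    obtain \<eta> where "\<eta> > 0"
      and \<eta>: "\<And>w. w \<in> X \<Longrightarrow> dist x w \<le> \<eta> \<Longrightarrow> \<exists>q\<in>omega_limit X f w. dist q p < e / 3"
      using LSC_approachable[OF lsc p \<open>p \<in> X\<close> \<open>e / 3 > 0\<close>] by blast
    obtain w m where "w \<in> X" "dist x w \<le> min \<eta> (e / 3)"
      and traced: "\<And>k. dist ((f ^^ k) y) ((f ^^ (k + m)) w) \<le> min \<eta> (e / 3)"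
      using Sh_traces_Omega_limit[OF f x y, of "min \<eta> (e / 3)"] \<open>\<eta> > 0\<close> \<open>e / 3 > 0\<close>
      by (metis min_less_iff_conj)
    then obtain q where q: "q \<in> omega_limit X f w" "dist q p < e / 3"
      using \<eta>[of w] by auto
    obtain n where "n \<ge> N" "dist ((f ^^ n) y) q < min \<eta> (e / 3) + e / 3"
      using omega_limit_approached_by_traced_orbit[OF traced q(1) \<open>e / 3 > 0\<close>] by blast
    moreover from this have "dist ((f ^^ n) y) p < e"
      using q(2) dist_triangle[of "(f ^^ n) y" p q] by linarith
    ultimately show ?thesis by blast
  qed
  with \<open>p \<in> X\<close> show "p \<in> omega_limit X f y"
    unfolding omega_limit_iff_frequently by blast
qed

theorem theorem3p1:
  fixes X :: "'a::metric_space set" and f :: "'a \<Rightarrow> 'a" and x :: 'a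
  assumes "compact X"
    and "continuous_on X f"
    and "f ` X \<subseteq> X"
    and "x \<in> Sh X f"
  shows "(x \<in> LSC X (omega_limit X f) \<longleftrightarrow>
            (\<forall>y \<in> Omega_limit X f x. omega_limit X f x \<subseteq> omega_limit X f y)) \<and>
         ((\<forall>y \<in> Omega_limit X f x. omega_limit X f x \<subseteq> omega_limit X f y) \<longrightarrow>
            minimal_set X f (omega_limit X f x))"
proof -
  have x: "x \<in> X"
    using assms(4) unfolding Sh_def by blast
  then have "continuous (at x within X) f"
    using assms(2) by (simp add: continuous_on_eq_continuous_within)
  then have "x \<in> LSC X (omega_limit X f) \<longleftrightarrow>
      (\<forall>y \<in> Omega_limit X f x. omega_limit X f x \<subseteq> omega_limit X f y)"
    using LSC_omega_limitI[OF assms(1-3) x] omega_limit_subset_of_LSC[OF _ assms(3,4)] by blast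
  moreover have "minimal_set X f (omega_limit X f x)"
    if "\<forall>y \<in> Omega_limit X f x. omega_limit X f x \<subseteq> omega_limit X f y"
    using minimal_set_omega_limitI[OF assms(1-3) x] omega_limit_subset_Omega_limit[OF x] that
    by blast
  ultimately show ?thesis by blast
qed

end
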